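(* For all integers $n\ge 1$, $$(-1)^{n-1}G_{2n}=\sum_{k=1}^{n}(-1)^{k-1}\,T(n,k)\,k\,\bigl((k-1)!\bigr)^2 .$$
   Context: The Genocchi numbers $G_{2n}$, $n\ge1$ ($1,1,3,17,155,\dots$), are defined by $\frac{2z}{1+e^z}=z+\sum_{n\ge 1}(-1)^nG_{2n}\frac{z^{2n}}{(2n)!}$. The central factorial numbers of the second kind $T(n,k)$, $n,k\ge0$, are defined by $T(0,0)=1$, $T(0,k)=0$ for $k\ge1$, $T(n,0)=0$ for $n\ge1$, and $T(n,k)=T(n-1,k-1)+k^2T(n-1,k)$ for $n,k\ge 1$. *)

theory Defs
  imports Main "HOL-Computational_Algebra.Formal_Power_Series"
begin

definition genocchi_gf :: "rat fps" where
  "genocchi_gf = 2 * fps_X / (1 + fps_exp 1)"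

text \<open>\<open>genocchi m\<close> stands for \<open>G\<^sub>m\<close>; only even \<open>m \<ge> 2\<close> are meaningful as Genocchi numbers.
  Lemma \<open>genocchi_gf_expansion\<close> recovers the defining expansion
  \<open>2z / (1 + e\<^sup>z) = z + (\<Sum>n\<ge>1. (-1)\<^sup>n G\<^sub>2\<^sub>n z\<^sup>2\<^sup>n / (2n)!)\<close>.\<close>

definition genocchi :: "nat \<Rightarrow> rat" where
  "genocchi m = (-1) ^ (m div 2) * fact m * fps_nth genocchi_gf m"

fun central_factorial2 :: "nat \<Rightarrow> nat \<Rightarrow> nat" where
  "central_factorial2 0 0 = 1"
| "central_factorial2 0 (Suc k) = 0"
| "central_factorial2 (Suc n) 0 = 0"
| "central_factorial2 (Suc n) (Suc k) =
     central_factorial2 n k + (Suc k)\<^sup>2 * central_factorial2 n (Suc k)"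

lemma genocchi_gf_mult: "genocchi_gf * (1 + fps_exp 1) = 2 * fps_X"
proof -
  have "fps_nth (1 + fps_exp 1 :: rat fps) 0 \<noteq> 0" by simp
  then show ?thesis
    unfolding genocchi_gf_def by (simp add: fps_divide_unit mult.assoc inverse_mult_eq_1)
qed

lemma genocchi_gf_reflect:
  "fps_compose genocchi_gf (- fps_X) = genocchi_gf - 2 * fps_X"
proof -
  let ?E = "fps_exp 1 :: rat fps" and ?N = "fps_exp (-1) :: rat fps"
  let ?H = "fps_compose genocchi_gf (- fps_X)"
  have X0: "fps_nth (- fps_X :: rat fps) 0 = 0" by simp
  have EN: "?E * ?N = 1"
    by (simp flip: fps_exp_add_mult)
  have comp: "fps_compose ?E (- fps_X) = ?N"
    by (rule fps_ext) (simp add: fps_compose_uminus')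
  have "fps_compose (genocchi_gf * (1 + ?E)) (- fps_X) = fps_compose (2 * fps_X) (- fps_X)"
    by (simp only: genocchi_gf_mult)
  then have "?H * (1 + ?N) = - (2 * fps_X)"
    by (simp add: fps_compose_mult_distrib[OF X0] fps_compose_add_distrib comp
        numeral_fps_const)
  then have "?H * (1 + ?N) * ?E = - (2 * fps_X) * ?E" by simp
  moreover have "?H * (1 + ?N) * ?E = ?H * (1 + ?E)"
    using EN by (simp add: algebra_simps)
  moreover have "(genocchi_gf - 2 * fps_X) * (1 + ?E) = - (2 * fps_X) * ?E"
    using genocchi_gf_mult by (simp add: algebra_simps)
  ultimately have "?H * (1 + ?E) = (genocchi_gf - 2 * fps_X) * (1 + ?E)" by simp
  moreover have "1 + ?E \<noteq> 0"
  proof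
    assume "1 + ?E = 0"
    then have "fps_nth (1 + ?E) 0 = 0" by simp
    then show False by simp
  qed
  ultimately show ?thesis by simp
qed

lemma genocchi_gf_expansion:
  "genocchi_gf = fps_X +
     Abs_fps (\<lambda>m. if even m \<and> m \<ge> 2 then (-1) ^ (m div 2) * genocchi m / fact m else 0)"
proof (rule fps_ext)
  fix m
  have refl: "(-1) ^ m * fps_nth genocchi_gf m = fps_nth genocchi_gf m - 2 * fps_nth fps_X m"
    using arg_cong[OF genocchi_gf_reflect, of "\<lambda>f. fps_nth f m"]
    by (simp add: fps_compose_uminus' numeral_fps_const)
  have "fps_nth (genocchi_gf * (1 + fps_exp 1)) 0 = 0"
    by (simp only: genocchi_gf_mult) simp
  then have zero: "fps_nth genocchi_gf 0 = 0" by simp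
  have sq: "(-1) ^ k * ((-1) ^ k * x) = (x :: rat)" for k x
    by (simp flip: mult.assoc power_mult_distrib)
  show "fps_nth genocchi_gf m = fps_nth (fps_X +
     Abs_fps (\<lambda>m. if even m \<and> m \<ge> 2 then (-1) ^ (m div 2) * genocchi m / fact m else 0)) m"
  proof (cases "even m")
    case True
    then have "m = 0 \<or> m \<ge> 2" by (cases m) (auto elim: oddE)
    with True zero show ?thesis by (auto simp: genocchi_def sq mult.assoc)
  next
    case False
    with refl have "fps_nth genocchi_gf m = fps_nth fps_X m" by simp
    with False show ?thesis by simp
  qed
qed

end

theory Submission
  imports Defs
begin

text \<open>Put \<open>x = e\<^sup>z + e\<^sup>-\<^sup>z - 2 = (2 sinh (z/2))\<^sup>2\<close> and \<open>w = x'\<close>, so that \<open>w\<^sup>2 = x (x + 4)\<close> and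
  \<open>w' = x + 2\<close>. Hence \<open>x\<^sup>k / (2k)!\<close> satisfies the recurrence of the central factorial numbers under
  two-fold differentiation and is their exponential generating function in \<open>z\<^sup>2\<^sup>n / (2n)!\<close>. The
  right-hand sides therefore have generating function \<open>F(x)\<close> for an explicit power series \<open>F\<close>,
  whose coefficient recurrence says \<open>w y' = x + 2 y\<close> for \<open>y = F(x)\<close>. The series
  \<open>y = z - 2z / (1 + e\<^sup>z)\<close>, i.e. \<open>z tanh (z/2)\<close>, solves the same equation, and a solution is
  determined by its coefficients of orders 0 and 1.\<close>

definition sinh_sq :: "rat fps" where
  "sinh_sq = fps_exp 1 + fps_exp (-1) - 2"

definition sinh_sq' :: "rat fps" where
  "sinh_sq' = fps_exp 1 - fps_exp (-1)"

text \<open>The series \<open>F\<close> of the overview. Its factor \<open>1 / fact (2 * k)\<close>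
  cancels the \<open>(2k)!\<close> in the coefficients of \<open>x^k\<close>. In closed form
  \<open>F(x) = 2 arsinh (sqrt x / 2) * sqrt (x / (x + 4))\<close>.\<close>

definition central_genocchi_series :: "rat fps" where
  "central_genocchi_series =
     Abs_fps (\<lambda>k. if k = 0 then 0 else (-1) ^ (k - 1) * of_nat k * (fact (k - 1))\<^sup>2 / fact (2 * k))"

lemma fps_exp_mult_inverse: "fps_exp 1 * fps_exp (-1) = (1 :: 'a :: field_char_0 fps)"
  by (simp flip: fps_exp_add_mult)

lemma sinh_sq_nth_0 [simp]: "fps_nth sinh_sq 0 = 0"
  by (simp add: sinh_sq_def numeral_fps_const)

lemma fps_deriv_sinh_sq: "fps_deriv sinh_sq = sinh_sq'"
  by (simp add: sinh_sq_def sinh_sq'_def numeral_fps_const flip: fps_const_neg)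

lemma fps_deriv_sinh_sq': "fps_deriv sinh_sq' = sinh_sq + 2"
  by (simp add: sinh_sq_def sinh_sq'_def flip: fps_const_neg)

lemma sinh_sq'_square: "sinh_sq'\<^sup>2 = sinh_sq * (sinh_sq + 4)"
  unfolding sinh_sq'_def sinh_sq_def using fps_exp_mult_inverse[where 'a = rat] by algebra

lemma fps_deriv2_sinh_sq_power:
  "fps_deriv (fps_deriv (sinh_sq ^ Suc k)) =
     of_nat (2 * Suc k * (2 * k + 1)) * sinh_sq ^ k + of_nat ((Suc k)\<^sup>2) * sinh_sq ^ Suc k"
proof -
  have "fps_deriv (sinh_sq ^ Suc k) = of_nat (Suc k) * (sinh_sq ^ k * sinh_sq')"
    by (simp only: fps_deriv_power' fps_deriv_sinh_sq diff_Suc_1 mult.assoc)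
      (simp add: mult_ac)
  then have "fps_deriv (fps_deriv (sinh_sq ^ Suc k)) =
      of_nat (Suc k) * (of_nat k * (sinh_sq ^ (k - 1) * sinh_sq'\<^sup>2) + sinh_sq ^ k * (sinh_sq + 2))"
    by (simp only: fps_deriv_mult fps_deriv_of_nat fps_deriv_power' fps_deriv_sinh_sq
        fps_deriv_sinh_sq') (simp add: power2_eq_square mult_ac)
  \<comment> \<open>The factor \<open>of_nat k\<close> makes the truncated exponent
    \<open>k - 1\<close> harmless at \<open>k = 0\<close>.\<close>
  also have "of_nat k * (sinh_sq ^ (k - 1) * sinh_sq'\<^sup>2) = of_nat k * (sinh_sq ^ k * (sinh_sq + 4))"
    by (cases k) (simp_all add: sinh_sq'_square)
  finally show ?thesis
    by (simp add: algebra_simps power2_eq_square)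
qed

lemma sinh_sq_power_nth:
  "fact (2 * n) * fps_nth (sinh_sq ^ k) (2 * n) = fact (2 * k) * of_nat (central_factorial2 n k)"
proof (induction n arbitrary: k)
  case 0
  show ?case by (cases k) simp_all
next
  case (Suc n)
  show ?case
  proof (cases k)
    case 0
    then show ?thesis by simp
  next
    case (Suc j)
    have "fact (2 * Suc n) * fps_nth (sinh_sq ^ k) (2 * Suc n) =
        fact (2 * n) * fps_nth (fps_deriv (fps_deriv (sinh_sq ^ k))) (2 * n)"
      by (simp add: algebra_simps)
    also have "\<dots> = of_nat (2 * Suc j * (2 * j + 1)) * (fact (2 * n) * fps_nth (sinh_sq ^ j) (2 * n))
        + of_nat ((Suc j)\<^sup>2) * (fact (2 * n) * fps_nth (sinh_sq ^ Suc j) (2 * n))"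
      unfolding Suc fps_deriv2_sinh_sq_power
      by (simp only: fps_add_nth fps_mult_of_nat_nth distrib_left mult.left_commute)
    also have "\<dots> = fact (2 * k) * of_nat (central_factorial2 (Suc n) k)"
      unfolding Suc.IH Suc by (simp add: algebra_simps power2_eq_square)
    finally show ?thesis .
  qed
qed

lemma central_factorial2_eq_0: "n < k \<Longrightarrow> central_factorial2 n k = 0"
  by (induction n k rule: central_factorial2.induct) auto

lemma central_genocchi_series_compose_nth:
  "fact (2 * n) * fps_nth (central_genocchi_series oo sinh_sq) (2 * n) =
     (\<Sum>k = 1..n. (-1) ^ (k - 1) * of_nat (central_factorial2 n k) * of_nat k * (fact (k - 1))\<^sup>2)"
proof -
  have "fact (2 * n) * fps_nth (central_genocchi_series oo sinh_sq) (2 * n) =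
      (\<Sum>k = 0..2 * n. fps_nth central_genocchi_series k *
         (fact (2 * n) * fps_nth (sinh_sq ^ k) (2 * n)))"
    by (simp add: fps_compose_nth sum_distrib_left mult_ac)
  also have "\<dots> = (\<Sum>k = 1..n. fps_nth central_genocchi_series k *
         (fact (2 * n) * fps_nth (sinh_sq ^ k) (2 * n)))"
    \<comment> \<open>The terms with \<open>k > n\<close> vanish because \<open>T(n,k) = 0\<close>,
      the term \<open>k = 0\<close> because \<open>F\<close> has no constant term.\<close>
    unfolding sinh_sq_power_nth
    by (rule sum.mono_neutral_right)
       (auto simp: central_factorial2_eq_0 central_genocchi_series_def not_le)
  also have "\<dots> = (\<Sum>k = 1..n. (-1) ^ (k - 1) * of_nat (central_factorial2 n k) * of_nat k
      * (fact (k - 1))\<^sup>2)"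
    unfolding sinh_sq_power_nth
    by (rule sum.cong) (auto simp: central_genocchi_series_def)
  finally show ?thesis .
qed

text \<open>At order \<open>k \<ge> 2\<close> this is the ratio
  \<open>(4k - 2) c_k = - (k - 1) c_(k-1)\<close> of consecutive coefficients; at order 1 the
  inhomogeneous term \<open>fps_X\<close> matches \<open>c_1 = 1/2\<close>.\<close>

lemma central_genocchi_series_ode:
  "fps_X * (fps_X + 4) * fps_deriv central_genocchi_series = fps_X + 2 * central_genocchi_series"
proof (rule fps_ext)
  fix k
  let ?c = "fps_nth central_genocchi_series"
  consider "k = 0" | "k = 1" | j where "k = Suc (Suc j)"
    by (metis One_nat_def not0_implies_Suc)
  then show "fps_nth (fps_X * (fps_X + 4) * fps_deriv central_genocchi_series) k =
      fps_nth (fps_X + 2 * central_genocchi_series) k"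
  proof cases
    case 1
    then show ?thesis
      by (simp add: central_genocchi_series_def numeral_fps_const mult.assoc)
  next
    case 2
    then show ?thesis
      by (simp add: central_genocchi_series_def numeral_fps_const mult.assoc distrib_right
          fact_numeral)
  next
    case (3 j)
    have fact_even: "fact (2 * Suc (Suc j)) =
        (2 * (of_nat j + 2) * (2 * of_nat j + 3) * fact (2 * Suc j) :: rat)"
      by (simp add: algebra_simps)
    define a e f N :: rat
      where defs: "a = of_nat j" "e = (-1) ^ j" "f = fact j" "N = fact (2 * Suc j)"
    have "a \<ge> 0" "N \<noteq> 0" by (simp_all add: defs)
    then have "a + 2 \<noteq> 0" "2 * a + 3 \<noteq> 0" by linarith+
    have "?c (Suc (Suc j)) = - e * (a + 2) * ((a + 1) * f)\<^sup>2 / (2 * (a + 2) * (2 * a + 3) * N)"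
      unfolding central_genocchi_series_def fps_nth_Abs_fps fact_even defs
      by (simp add: add_ac del: mult_Suc_right)
    moreover have "?c (Suc j) = e * (a + 1) * f\<^sup>2 / N"
      unfolding central_genocchi_series_def fps_nth_Abs_fps defs
      by (simp add: add_ac del: mult_Suc_right)
    moreover have "2 * (2 * a + 3) * (- e * (a + 2) * ((a + 1) * f)\<^sup>2 / (2 * (a + 2) * (2 * a + 3) * N))
        = - (a + 1) * (e * (a + 1) * f\<^sup>2 / N)"
      using \<open>N \<noteq> 0\<close> \<open>a + 2 \<noteq> 0\<close> \<open>2 * a + 3 \<noteq> 0\<close> by (simp add: divide_simps) algebra
    ultimately have "2 * (2 * of_nat j + 3) * ?c (Suc (Suc j)) = - (of_nat j + 1) * ?c (Suc j)"
      by (simp only: defs(1))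
    then show ?thesis
      unfolding 3 by (simp add: numeral_fps_const mult.assoc distrib_right algebra_simps)
  qed
qed

text \<open>By the chain rule \<open>w P' = w^2 F'(x) = x (x + 4) F'(x)\<close>, so the equation for
  \<open>F\<close> can be composed with \<open>x\<close>.\<close>

lemma central_genocchi_compose_ode:
  defines "P \<equiv> central_genocchi_series oo sinh_sq"
  shows "sinh_sq' * fps_deriv P = sinh_sq + 2 * P"
proof -
  have "sinh_sq' * fps_deriv P =
      (fps_X * (fps_X + 4) * fps_deriv central_genocchi_series) oo sinh_sq"
    unfolding P_def fps_compose_deriv[OF sinh_sq_nth_0] fps_deriv_sinh_sq
    using sinh_sq'_square
    by (simp add: fps_compose_mult_distrib fps_compose_add_distrib numeral_fps_const
        power2_eq_square mult_ac)
  then show ?thesis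
    unfolding central_genocchi_series_ode P_def
    by (simp add: fps_compose_mult_distrib fps_compose_add_distrib numeral_fps_const)
qed

lemma genocchi_gf_ode:
  defines "Q \<equiv> fps_X - genocchi_gf"
  shows "sinh_sq' * fps_deriv Q = sinh_sq + 2 * Q"
proof -
  let ?E = "fps_exp 1 :: rat fps" and ?N = "fps_exp (-1) :: rat fps"
  have Q: "Q * (1 + ?E) = fps_X * (?E - 1)"
    using genocchi_gf_mult by (simp add: Q_def algebra_simps)
  then have "fps_deriv (Q * (1 + ?E)) = fps_deriv (fps_X * (?E - 1))"
    by simp
  then have Q': "fps_deriv Q * (1 + ?E) + Q * ?E = ?E - 1 + fps_X * ?E"
    by (simp add: algebra_simps)
  \<comment> \<open>With the denominator \<open>1 + e^z\<close> cleared, this is a polynomial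
    consequence of \<open>Q\<close>, \<open>Q'\<close> and \<open>e^z e^(-z) = 1\<close>.\<close>
  have "(sinh_sq' * fps_deriv Q) * (1 + ?E) = (sinh_sq + 2 * Q) * (1 + ?E)"
    unfolding sinh_sq_def sinh_sq'_def
    using Q Q' fps_exp_mult_inverse[where 'a = rat] by algebra
  moreover have "1 + ?E \<noteq> 0"
  proof
    assume "1 + ?E = 0"
    then have "fps_nth (1 + ?E) 0 = 0" by simp
    then show False by simp
  qed
  ultimately show ?thesis by simp
qed

text \<open>Since \<open>w = 2z + ...\<close>, order \<open>m\<close> of the equation reads
  \<open>2 m h_m + (lower h_i) = 2 h_m\<close>. This determines \<open>h_m\<close> for
  \<open>m \<ge> 2\<close> but degenerates at \<open>m = 1\<close>, where \<open>h_1\<close> has to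
  be prescribed.\<close>

lemma sinh_sq_ode_unique:
  assumes ode: "sinh_sq' * fps_deriv H = 2 * H"
    and "fps_nth H 0 = 0" "fps_nth H 1 = 0"
  shows "H = 0"
proof (rule fps_ext)
  fix m
  show "fps_nth H m = fps_nth 0 m"
  proof (induction m rule: less_induct)
    case (less m)
    show ?case
    proof (cases "m \<le> 1")
      case True
      with assms(2,3) show ?thesis by (cases m) auto
    next
      case False
      have "2 * fps_nth H m = (\<Sum>i = 0..m. fps_nth sinh_sq' i * fps_nth (fps_deriv H) (m - i))"
        using arg_cong[OF ode, of "\<lambda>f. fps_nth f m"]
        by (simp add: fps_mult_nth [of sinh_sq'] numeral_fps_const)
      \<comment> \<open>The term \<open>i = 0\<close> drops out because \<open>w\<close> has no
        constant term; for \<open>i \<ge> 2\<close> the derivative involves only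
        \<open>h_(m-i+1)\<close>, which is zero by induction.\<close>
      also have "\<dots> = (\<Sum>i \<in> {1}. fps_nth sinh_sq' i * fps_nth (fps_deriv H) (m - i))"
      proof (rule sum.mono_neutral_right)
        show "\<forall>i \<in> {0..m} - {1}. fps_nth sinh_sq' i * fps_nth (fps_deriv H) (m - i) = 0"
        proof
          fix i assume "i \<in> {0..m} - {1}"
          then consider "i = 0" | "m - i + 1 < m" by fastforce
          then show "fps_nth sinh_sq' i * fps_nth (fps_deriv H) (m - i) = 0"
            using less.IH by cases (auto simp: sinh_sq'_def)
        qed
      qed (use False in auto)
      also have "\<dots> = 2 * of_nat m * fps_nth H m"
        using False by (simp add: sinh_sq'_def)
      finally show ?thesis using False by auto
    qed
  qed
qed

lemma central_genocchi_series_compose: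
  "central_genocchi_series oo sinh_sq = fps_X - genocchi_gf"
proof -
  let ?P = "central_genocchi_series oo sinh_sq" and ?Q = "fps_X - genocchi_gf"
  have "?P - ?Q = 0"
  proof (rule sinh_sq_ode_unique)
    show "sinh_sq' * fps_deriv (?P - ?Q) = 2 * (?P - ?Q)"
      using central_genocchi_compose_ode genocchi_gf_ode
      by (simp only: fps_deriv_sub right_diff_distrib) simp
  \<comment> \<open>Both series start at order 2: \<open>x\<close> does, and the expansion of
    \<open>genocchi_gf\<close> agrees with \<open>fps_X\<close> up to order 1.\<close>
  qed (subst genocchi_gf_expansion,
      simp add: fps_compose_nth central_genocchi_series_def sinh_sq_def numeral_fps_const)+
  then show ?thesis by simp
qed

theorem mainTheorem4:
  fixes n :: nat
  assumes "n \<ge> 1"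
  shows "(-1) ^ (n - 1) * genocchi (2 * n) =
    (\<Sum>k = 1..n. (-1) ^ (k - 1) * of_nat (central_factorial2 n k) * of_nat k * (fact (k - 1))\<^sup>2)"
proof -
  from assms obtain m where n: "n = Suc m" by (cases n) auto
  have "(-1) ^ (n - 1) * genocchi (2 * n) = - (fact (2 * n) * fps_nth genocchi_gf (2 * n))"
    by (simp add: genocchi_def n flip: mult.assoc power_mult_distrib)
  \<comment> \<open>The term \<open>fps_X\<close> contributes nothing at an even order.\<close>
  also have "\<dots> = fact (2 * n) * fps_nth (central_genocchi_series oo sinh_sq) (2 * n)"
    by (simp add: central_genocchi_series_compose)
  finally show ?thesis
    unfolding central_genocchi_series_compose_nth .
qed

end
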